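(* Suppose the operator $A$ is bounded on $\mathcal H$ and that the following two convergence hypotheses hold: $$\lim_{h\to 0}\ \overset{\circ}{\beta}(h)^{-1}\inf_{w\in \mathcal S_{1,h}}\|v-w\|_{\mathcal H}=0\quad\text{for each } v\in\mathcal H,\qquad\text{and}\qquad \lim_{h\to 0}\delta_{\mathcal H}(A_h,A)=0 .$$ Then there exist $h_0>0$ and a constant $c>0$ such that for each $h<h_0$ and each $u\in\mathcal U$ with $\|u\|_{\mathcal H}=1$ there is a $u_h\in\mathcal U_h$ with $$\|u_h-Q_hu\|_{\mathcal H}\le c\,\varepsilon_{\mathcal H}(h)\,\delta_{\mathcal H}(\mathcal U,\mathcal S_{1,h}),$$ where $c$ is independent of $h$ and independent of the choice of $u$.
   Context: Inner products and sesquilinear forms are conjugate linear in the first argument. $\mathcal H$ is a complex separable Hilbert space. $a(\cdot,\cdot)$ is a closed, densely defined, sectorial sesquilinear form in $\mathcal H$ with domain $\mathcal V=\mathrm{Dom}(a)$: for some fixed $\alpha,M>0$, $\mathrm{Re}\,a(v,v)\ge\alpha\|v\|_{\mathcal H}^2$ and $|\mathrm{Im}\,a(v,v)|\le M(\mathrm{Re}\,a(v,v)-\alpha\|v\|_{\mathcal H}^2)$ for all $v\in\mathcal V$. $\mathcal V$ is a Hilbert space under an inner product $\langle\cdot,\cdot\rangle_{\mathcal V}$ equivalent to $\frac12\big(a(w,v)+\overline{a(v,w)}\big)$. $A$ is the closed m-sectorial operator in $\mathcal H$ associated with $a$: $\mathrm{Dom}(A)=\{v\in\mathcal V: \exists\,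 m_v,\ |a(w,v)|\le m_v\|w\|_{\mathcal H}\ \forall w\in\mathcal V\}$ and $a(w,v)=\langle w,Av\rangle_{\mathcal H}$ for $v\in \mathrm{Dom}(A)$, $w\in\mathcal V$. Here $A$ is bounded, so $\mathrm{Dom}(A)=\mathcal V=\mathcal H$. $\lambda\ne0$ is an isolated eigenvalue of $A$ of finite algebraic multiplicity $m$, and $\mathcal U=\bigcup_{k\ge1}\mathrm{Ker}[(A-\lambda I)^k]$ is the associated $m$-dimensional maximal invariant subspace (the range of the spectral projection of $A$ for $\lambda$). For each $h>0$, $\mathcal S_{1,h},\mathcal S_{2,h}\subset\mathcal V$ are subspaces of the same finite dimension $N(h)$ satisfying $$\beta(h)=\inf_{u\in\mathcal S_{2,h},\|u\|_{\mathcal V}=1}\ \sup_{v\in\mathcal S_{1,h},\|v\|_{\mathcal V}=1}|a(u,v)|>0,\qquad \overset{\circ}{\beta}(h)=\inf_{u\in\mathcal S_{2,h},\|u\|_{\mathcal H}=1}\ \sup_{v\in\mathcal S_{1,h},\|v\|_{\mathcal H}=1}|\langle u,v\rangle_{\mathcal H}|>0.$$ $Q_h$ is the (generally oblique) projection of $\mathcal H$ onto $\mathcal S_{1,h}$ defined by $\langle u,v-Q_hv\rangle_{\mathcal H}=0$ for all $u\in\mathcal S_{2,h}$. $A_h=Q_hAQ_h$. $\Pi_{1,h}$ is the $\mathcal H$-orthogonal projection onto $\mathcal S_{1,h}$. For closed subspaces $\mathcal M,\mathcal N$ of $\mathcal H$, $\delta_{\mathcal H}(\mathcal M,\mathcal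 N)=\sup_{0\ne x\in\mathcal M}\inf_{y\in\mathcal N}\|y-x\|_{\mathcal H}/\|x\|_{\mathcal H}$. For closed operators $L,B$ in $\mathcal H$, $\delta_{\mathcal H}(L,B)=\sup_{0\neq x\in \mathrm{Dom}(L)}\inf_{y\in \mathrm{Dom}(B)}\frac{\|x-y\|_{\mathcal H}+\|Lx-By\|_{\mathcal H}}{\|x\|_{\mathcal H}+\|Lx\|_{\mathcal H}}$. In $\delta_{\mathcal H}(A_h,A)$, the operator $A_h$ is regarded as having domain $\mathcal S_{1,h}$. Let $\Gamma$ be a circle in $\mathbb C$ centered at $\lambda$ with the origin and all points of $\sigma(A)$ other than $\lambda$ in its exterior. Under the two convergence hypotheses, for all sufficiently small $h$ exactly $m$ eigenvalues of $A_h$ (counting multiplicity) lie inside $\Gamma$ and none on $\Gamma$; $\mathcal U_h\subset \mathcal S_{1,h}$ denotes the $m$-dimensional $A_h$-invariant subspace associated with them, i.e. the range of $E_h=\frac1{2\pi i}\int_\Gamma(z-A_h)^{-1}dz$. Finally, $$\varepsilon_{\mathcal H}(h)=\sup_{u\in\mathcal U}\frac{\|Q_hA(I-Q_h)u\|_{\mathcal H}}{\|(I-\Pi_{1,h})u\|_{\mathcal H}},$$ where quotients $0/0$ are read as $0$ (the numerator vanishes whenever the denominator does). *)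

theory Defs
  imports "HOL-Complex_Analysis.Complex_Analysis"
begin

text \<open>
  Complex Hilbert spaces. The inner product is conjugate linear in its first argument.
  Additivity and homogeneity in the second argument follow from conjugate symmetry;
  definiteness follows from the norm axioms of \<^class>\<open>banach\<close>.
\<close>

class complex_hilbert_space = banach +
  fixes scaleC :: "complex \<Rightarrow> 'a \<Rightarrow> 'a" (infixr \<open>*\<^sub>C\<close> 75)
    and cinner :: "'a \<Rightarrow> 'a \<Rightarrow> complex"
  assumes scaleC_add_right: "c *\<^sub>C (x + y) = c *\<^sub>C x + c *\<^sub>C y"
    and scaleC_add_left: "(c + d) *\<^sub>C x = c *\<^sub>C x + d *\<^sub>C x"
    and scaleC_scaleC: "c *\<^sub>C d *\<^sub>C x = (c * d) *\<^sub>C x"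
    and scaleR_scaleC: "r *\<^sub>R x = complex_of_real r *\<^sub>C x"
    and cinner_commute: "cinner x y = cnj (cinner y x)"
    and cinner_add_left: "cinner (x + y) z = cinner x z + cinner y z"
    and cinner_scaleC_left: "cinner (c *\<^sub>C x) y = cnj c * cinner x y"
    and cinner_self: "cinner x x = complex_of_real ((norm x)\<^sup>2)"

global_interpretation complex_vector:
  vector_space "scaleC :: complex \<Rightarrow> 'a \<Rightarrow> 'a::complex_hilbert_space"
  defines csubspace = complex_vector.subspace
    and cspan = complex_vector.span
    and cdependent = complex_vector.dependent
proof unfold_locales
  show "1 *\<^sub>C x = x" for x :: 'a
    using scaleR_scaleC[of 1 x] by simp
qed (rule scaleC_add_right scaleC_add_left scaleC_scaleC)+

text \<open>
  Dimension as a relation, so that it is never confused with the value 0 that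
  the library's \<open>dim\<close> assigns to infinite-dimensional spaces.
\<close>

definition has_cdim :: "'a::complex_hilbert_space set \<Rightarrow> nat \<Rightarrow> bool" where
  "has_cdim S n \<longleftrightarrow> (\<exists>B. finite B \<and> card B = n \<and> \<not> cdependent B \<and> cspan B = S)"


subsection \<open>Sesquilinear forms and associated operators\<close>

definition sesquilinear_on :: "'a::complex_hilbert_space set \<Rightarrow> ('a \<Rightarrow> 'a \<Rightarrow> complex) \<Rightarrow> bool" where
  "sesquilinear_on V b \<longleftrightarrow> csubspace V \<and>
     (\<forall>u\<in>V. \<forall>v\<in>V. \<forall>w\<in>V. b (u + v) w = b u w + b v w \<and> b w (u + v) = b w u + b w v) \<and>
     (\<forall>c. \<forall>v\<in>V. \<forall>w\<in>V. b (c *\<^sub>C v) w = cnj c * b v w \<and> b w (c *\<^sub>C v) = c * b w v)"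

text \<open>Closedness in the sense of Kato.\<close>

definition closed_form :: "'a::complex_hilbert_space set \<Rightarrow> ('a \<Rightarrow> 'a \<Rightarrow> complex) \<Rightarrow> bool" where
  "closed_form V a \<longleftrightarrow> (\<forall>X x.
     (\<forall>n. X n \<in> V) \<and> X \<longlonglongrightarrow> x \<and>
     (\<forall>e>0. \<exists>n0. \<forall>m\<ge>n0. \<forall>n\<ge>n0. cmod (a (X m - X n) (X m - X n)) < e)
     \<longrightarrow> x \<in> V \<and> (\<lambda>n. a (X n - x) (X n - x)) \<longlonglongrightarrow> 0)"

definition sectorial_form ::
  "'a::complex_hilbert_space set \<Rightarrow> ('a \<Rightarrow> 'a \<Rightarrow> complex) \<Rightarrow> real \<Rightarrow> real \<Rightarrow> bool" where
  "sectorial_form V a \<alpha> M \<longleftrightarrow> (\<forall>v\<in>V.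
     Re (a v v) \<ge> \<alpha> * (norm v)\<^sup>2 \<and>
     \<bar>Im (a v v)\<bar> \<le> M * (Re (a v v) - \<alpha> * (norm v)\<^sup>2))"

definition form_norm :: "('a \<Rightarrow> 'a \<Rightarrow> complex) \<Rightarrow> 'a \<Rightarrow> real" where
  "form_norm b v = sqrt (Re (b v v))"

definition hilbert_on :: "'a::complex_hilbert_space set \<Rightarrow> ('a \<Rightarrow> 'a \<Rightarrow> complex) \<Rightarrow> bool" where
  "hilbert_on V ip \<longleftrightarrow> sesquilinear_on V ip \<and>
     (\<forall>v\<in>V. \<forall>w\<in>V. ip v w = cnj (ip w v)) \<and>
     (\<forall>v\<in>V. v \<noteq> 0 \<longrightarrow> Re (ip v v) > 0) \<and>
     (\<forall>X. (\<forall>n. X n \<in> V) \<and>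
          (\<forall>e>0. \<exists>n0. \<forall>m\<ge>n0. \<forall>n\<ge>n0. form_norm ip (X m - X n) < e)
          \<longrightarrow> (\<exists>x\<in>V. (\<lambda>n. form_norm ip (X n - x)) \<longlonglongrightarrow> 0))"

definition hermitian_part :: "('a \<Rightarrow> 'a \<Rightarrow> complex) \<Rightarrow> 'a \<Rightarrow> 'a \<Rightarrow> complex" where
  "hermitian_part a w v = (a w v + cnj (a v w)) / 2"

definition equivalent_ip :: "'a set \<Rightarrow> ('a \<Rightarrow> 'a \<Rightarrow> complex) \<Rightarrow> ('a \<Rightarrow> 'a \<Rightarrow> complex) \<Rightarrow> bool" where
  "equivalent_ip V ip1 ip2 \<longleftrightarrow> (\<exists>c1>0. \<exists>c2>0. \<forall>v\<in>V.
     c1 * form_norm ip2 v \<le> form_norm ip1 v \<and> form_norm ip1 v \<le> c2 * form_norm ip2 v)"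

definition op_dom :: "'a::complex_hilbert_space set \<Rightarrow> ('a \<Rightarrow> 'a \<Rightarrow> complex) \<Rightarrow> 'a set" where
  "op_dom V a = {v \<in> V. \<exists>m. \<forall>w\<in>V. cmod (a w v) \<le> m * norm w}"

text \<open>For dense \<open>V\<close> this determines \<open>A\<close> uniquely on \<open>op_dom V a\<close>.\<close>

definition associated_operator ::
  "'a::complex_hilbert_space set \<Rightarrow> ('a \<Rightarrow> 'a \<Rightarrow> complex) \<Rightarrow> ('a \<Rightarrow> 'a) \<Rightarrow> bool" where
  "associated_operator V a A \<longleftrightarrow> (\<forall>v\<in>op_dom V a. \<forall>w\<in>V. a w v = cinner w (A v))"


subsection \<open>Spectral notions for everywhere defined operators\<close>

definition resolvent ::
  "('a::complex_hilbert_space \<Rightarrow> 'a) \<Rightarrow> complex \<Rightarrow> 'a \<Rightarrow> 'a" where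
  "resolvent T z = inv (\<lambda>x. z *\<^sub>C x - T x)"

definition spectrum :: "('a::complex_hilbert_space \<Rightarrow> 'a) \<Rightarrow> complex set" where
  "spectrum T = {z. \<not> (bij (\<lambda>x. z *\<^sub>C x - T x) \<and> bounded_linear (resolvent T z))}"

definition eigenvalue :: "('a::complex_hilbert_space \<Rightarrow> 'a) \<Rightarrow> complex \<Rightarrow> bool" where
  "eigenvalue T z \<longleftrightarrow> (\<exists>v. v \<noteq> 0 \<and> T v = z *\<^sub>C v)"

definition gen_eigenspace :: "('a::complex_hilbert_space \<Rightarrow> 'a) \<Rightarrow> complex \<Rightarrow> 'a set" where
  "gen_eigenspace T z = (\<Union>k\<in>{1..}. {v. ((\<lambda>x. T x - z *\<^sub>C x) ^^ k) v = 0})"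

text \<open>
  The library's \<^const>\<open>contour_integral\<close> is restricted to complex-valued integrands;
  this is the same formula for vector-valued ones.
\<close>

definition vec_contour_integral ::
  "(real \<Rightarrow> complex) \<Rightarrow> (complex \<Rightarrow> 'a::complex_hilbert_space) \<Rightarrow> 'a" where
  "vec_contour_integral g f =
     integral {0..1} (\<lambda>t. vector_derivative g (at t within {0..1}) *\<^sub>C f (g t))"

text \<open>
  The integral of the operator-valued resolvent is taken pointwise. This agrees with the integral
  in operator norm because the resolvent is norm continuous off the spectrum.
\<close>

definition riesz_projection ::
  "('a::complex_hilbert_space \<Rightarrow> 'a) \<Rightarrow> complex \<Rightarrow> real \<Rightarrow> 'a \<Rightarrow> 'a" where
  "riesz_projection T z0 r x =
     (1 / (2 * of_real pi * \<i>)) *\<^sub>C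
       vec_contour_integral (circlepath z0 r) (\<lambda>z. resolvent T z x)"

text \<open>
  The algebraic multiplicity of an isolated eigenvalue is the dimension of the range of
  its spectral projection, which does not depend on the separating radius \<open>\<rho>\<close>.
\<close>

definition isolated_eigenvalue_mult ::
  "('a::complex_hilbert_space \<Rightarrow> 'a) \<Rightarrow> complex \<Rightarrow> nat \<Rightarrow> bool" where
  "isolated_eigenvalue_mult T z m \<longleftrightarrow> eigenvalue T z \<and>
     (\<exists>\<rho>>0. spectrum T \<inter> cball z \<rho> = {z} \<and> has_cdim (range (riesz_projection T z \<rho>)) m)"


subsection \<open>Petrov-Galerkin quantities\<close>

text \<open>
  Suprema and infima are formed in \<^typ>\<open>ennreal\<close>, where they are total with
  the usual conventions for empty sets, and where \<open>0 / 0 = 0\<close> and \<open>x / 0 = \<infinity>\<close> for \<open>x > 0\<close>.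
\<close>

definition inf_sup ::
  "('a \<Rightarrow> real) \<Rightarrow> ('a \<Rightarrow> 'a \<Rightarrow> complex) \<Rightarrow> 'a set \<Rightarrow> 'a set \<Rightarrow> ennreal" where
  "inf_sup nrm b S1 S2 =
     (INF u\<in>{u\<in>S2. nrm u = 1}. SUP v\<in>{v\<in>S1. nrm v = 1}. ennreal (cmod (b u v)))"

definition oblique_proj ::
  "'a::complex_hilbert_space set \<Rightarrow> 'a set \<Rightarrow> 'a \<Rightarrow> 'a" where
  "oblique_proj S1 S2 v = (THE w. w \<in> S1 \<and> (\<forall>u\<in>S2. cinner u (v - w) = 0))"

definition orth_proj :: "'a::complex_hilbert_space set \<Rightarrow> 'a \<Rightarrow> 'a" where
  "orth_proj S = oblique_proj S S"

definition subspace_gap :: "'a::complex_hilbert_space set \<Rightarrow> 'a set \<Rightarrow> ennreal" where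
  "subspace_gap M N = (SUP x\<in>M - {0}. (INF y\<in>N. ennreal (norm (y - x))) / ennreal (norm x))"

definition operator_gap ::
  "'a::complex_hilbert_space set \<Rightarrow> ('a \<Rightarrow> 'a) \<Rightarrow> 'a set \<Rightarrow> ('a \<Rightarrow> 'a) \<Rightarrow> ennreal" where
  "operator_gap DL L DB B =
     (SUP x\<in>DL - {0}.
        (INF y\<in>DB. ennreal (norm (x - y) + norm (L x - B y))) / ennreal (norm x + norm (L x)))"

definition galerkin_op ::
  "('a::complex_hilbert_space \<Rightarrow> 'a) \<Rightarrow> 'a set \<Rightarrow> 'a set \<Rightarrow> 'a \<Rightarrow> 'a" where
  "galerkin_op A S1 S2 = oblique_proj S1 S2 \<circ> A \<circ> oblique_proj S1 S2"

definition galerkin_eps ::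
  "('a::complex_hilbert_space \<Rightarrow> 'a) \<Rightarrow> 'a set \<Rightarrow> 'a set \<Rightarrow> 'a set \<Rightarrow> ennreal" where
  "galerkin_eps A U S1 S2 =
     (SUP u\<in>U. ennreal (norm (oblique_proj S1 S2 (A (u - oblique_proj S1 S2 u))))
                / ennreal (norm (u - orth_proj S1 u)))"

end

theory Submission
  imports Defs
begin

text \<open>
  Write \<open>Q\<close> for the oblique projection onto \<open>S1 h\<close>, \<open>Ah = Q A Q\<close>, and let \<open>Eh\<close> be the spectral
  projection of \<open>Ah\<close> for the circle \<open>\<Gamma>\<close> of radius \<open>r\<close> around \<open>\<mu>\<close>. The required element of its range is
  \<open>Eh (Q u)\<close>. Two estimates carry the proof.

  Consistency. For \<open>u \<in> U\<close> and \<open>z \<in> \<Gamma>\<close> put \<open>w = (z - A)\<inverse> u\<close>, which again lies in \<open>U\<close>. Since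
  \<open>Q (z - A) - (z - Ah) Q = - Q A (1 - Q)\<close>, one has
  \<open>(z - Ah)\<inverse> Q u - Q w = - (z - Ah)\<inverse> Q A (w - Q w)\<close>. With
  \<open>\<epsilon> = galerkin_eps A U (S1 h) (S2 h)\<close>, \<open>\<delta> = subspace_gap U (S1 h)\<close> and the orthogonal projection
  \<open>\<Pi>\<close> onto \<open>S1 h\<close>,
  \<open>norm (Q A (w - Q w)) \<le> \<epsilon> norm (w - \<Pi> w) \<le> \<epsilon> \<delta> norm w\<close>. Integrating over \<open>\<Gamma>\<close> turns the
  left-hand side into \<open>Eh (Q u) - Q u\<close>, because \<open>w\<close> is a Laurent polynomial in \<open>z - \<mu>\<close> with residue
  \<open>u\<close>. This is \<open>riesz_projection_error\<close> together with \<open>consistency_error_le\<close>.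

  Stability. It remains to bound \<open>(z - A)\<inverse>\<close> on \<open>\<Gamma>\<close>, which follows from compactness of \<open>\<Gamma>\<close>
  (\<open>uniform_lower_bound_off_spectrum\<close>), and \<open>(z - Ah)\<inverse>\<close> on \<open>S1 h\<close>, uniformly in \<open>z \<in> \<Gamma>\<close> and in small
  \<open>h\<close>. The latter follows from the former, because the graph of \<open>Ah\<close> over \<open>S1 h\<close> gets close to that of \<open>A\<close>
  (\<open>lower_bound_of_operator_gap\<close>); on a finite-dimensional space a lower bound for \<open>z - Ah\<close> is a bound
  for its inverse.

  The projection \<open>Q\<close> exists by a dimension count, from the positivity of the inf-sup constant and
  the equality of the two dimensions (\<open>oblique_pair_of_inf_sup_pos\<close>).
\<close>

section \<open>Complex linear algebra\<close>

lemma cinner_scaleC_right: "cinner x (c *\<^sub>C y) = c * cinner x y"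
  by (simp add: cinner_commute[of x] cinner_scaleC_left)

lemma norm_scaleC [simp]: "norm (c *\<^sub>C x) = cmod c * norm (x::'a::complex_hilbert_space)"
proof -
  have "complex_of_real ((norm (c *\<^sub>C x))\<^sup>2) = c * cnj c * cinner x x"
    unfolding cinner_self[symmetric] by (simp add: cinner_scaleC_left cinner_scaleC_right)
  also have "\<dots> = complex_of_real ((cmod c * norm x)\<^sup>2)"
    by (simp add: cinner_self complex_norm_square[symmetric] power_mult_distrib)
  finally have "(norm (c *\<^sub>C x))\<^sup>2 = (cmod c * norm x)\<^sup>2"
    using of_real_eq_iff by blast
  then show ?thesis
    by (simp add: power2_eq_iff_nonneg)
qed

lemma cinner_add_right: "cinner x (y + z) = cinner x y + cinner x z"
  by (simp add: cinner_commute[of x] cinner_add_left)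

lemma cinner_eq_0_commute: "cinner x y = 0 \<longleftrightarrow> cinner y x = 0"
  by (simp add: cinner_commute[of x])

lemma cinner_zero_left [simp]: "cinner 0 y = 0"
  using cinner_add_left[of 0 0 y] by simp

lemma cinner_zero_right [simp]: "cinner x 0 = 0"
  using cinner_add_right[of x 0 0] by simp

lemma cinner_diff_left: "cinner (x - y) z = cinner x z - cinner y z"
  using cinner_add_left[of "x - y" y z] by simp

lemma cinner_diff_right: "cinner x (y - z) = cinner x y - cinner x z"
  using cinner_add_right[of x "y - z" z] by simp

lemma cinner_self_eq_0 [simp]: "cinner x x = 0 \<longleftrightarrow> x = 0"
  by (simp add: cinner_self)

lemma norm_pythagoras_le:
  assumes "cinner x y = 0"
  shows "norm x \<le> norm (x + y)"
proof -
  have "cinner y x = 0"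
    using assms cinner_commute[of y x] by simp
  then have "cinner (x + y) (x + y) = cinner x x + cinner y y"
    using assms by (simp add: cinner_add_left cinner_add_right)
  then have "complex_of_real ((norm (x + y))\<^sup>2) = complex_of_real ((norm x)\<^sup>2 + (norm y)\<^sup>2)"
    by (simp add: cinner_self)
  then have "(norm (x + y))\<^sup>2 = (norm x)\<^sup>2 + (norm y)\<^sup>2"
    using of_real_eq_iff by blast
  then show ?thesis
    using power2_le_imp_le[of "norm x" "norm (x + y)"] by simp
qed

abbreviation clinear :: "('a::complex_hilbert_space \<Rightarrow> 'b::complex_hilbert_space) \<Rightarrow> bool" where
  "clinear \<equiv> Vector_Spaces.linear scaleC scaleC"

interpretation complex_vector_pair: vector_space_pair
    "scaleC :: complex \<Rightarrow> 'a \<Rightarrow> 'a::complex_hilbert_space"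
    "scaleC :: complex \<Rightarrow> 'b \<Rightarrow> 'b::complex_hilbert_space"
  by unfold_locales

lemma clinearI:
  assumes "\<And>x y. f (x + y) = f x + f y" "\<And>c x. f (c *\<^sub>C x) = c *\<^sub>C f x"
  shows "clinear f"
  by (intro Vector_Spaces.linear_iff[THEN iffD2] conjI allI complex_vector.vector_space_axioms assms)

lemmas clinear_add = complex_vector_pair.linear_add
  and clinear_scale = complex_vector_pair.linear_scale
  and clinear_diff = complex_vector_pair.linear_diff
  and clinear_0 = complex_vector_pair.linear_0
  and clinear_sum = complex_vector_pair.linear_sum

lemma has_cdim_csubspace: "has_cdim S n \<Longrightarrow> csubspace S"
  unfolding has_cdim_def using complex_vector.subspace_span by blast

text \<open>
  The linear maps below act on the whole Hilbert space and restrict to finite-dimensional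
  subspaces, so the dimension count is carried out by hand: the image of a basis of \<open>S\<close> is an
  independent subset of \<open>S'\<close> with \<open>n\<close> elements, and a vector of \<open>S'\<close> outside its span would
  enlarge it to \<open>n + 1\<close> independent vectors in an \<open>n\<close>-dimensional space.
\<close>

lemma injective_clinear_onto_of_same_dim:
  assumes T: "clinear T" and S: "has_cdim S n" and S': "has_cdim S' n"
    and into: "\<And>x. x \<in> S \<Longrightarrow> T x \<in> S'"
    and inj: "\<And>x. x \<in> S \<Longrightarrow> T x = 0 \<Longrightarrow> x = 0"
  shows "T ` S = S'"
proof -
  obtain B where B: "finite B" "card B = n" "\<not> cdependent B" "cspan B = S"
    using S unfolding has_cdim_def by blast
  obtain B' where B': "finite B'" "card B' = n" "cspan B' = S'"
    using S' unfolding has_cdim_def by blast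
  have injB: "inj_on T (cspan B)"
    using B inj clinear_diff[OF T] complex_vector.subspace_diff[OF complex_vector.subspace_span[of B]]
    by (intro inj_onI) (metis right_minus_eq)
  have indep: "\<not> cdependent (T ` B)"
    using complex_vector_pair.linear_independent_injective_image[OF T, of B] B(3) injB
    unfolding cdependent_def cspan_def by blast
  have card: "card (T ` B) = n"
    using B(2) injB complex_vector.span_superset[of B] by (metis card_image inj_on_subset)
  have sub: "T ` B \<subseteq> cspan B'"
    using into B B' complex_vector.span_base[of _ B] by auto
  have "S' \<subseteq> cspan (T ` B)"
  proof
    fix y assume y: "y \<in> S'"
    show "y \<in> cspan (T ` B)"
    proof (rule ccontr)
      assume notin: "y \<notin> cspan (T ` B)"
      then have "\<not> cdependent (insert y (T ` B))"
        using indep complex_vector.independent_insertI by blast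
      then have "card (insert y (T ` B)) \<le> card B'"
        using complex_vector.independent_span_bound[OF B'(1)] sub y B'(3) by auto
      moreover have "y \<notin> T ` B"
        using notin complex_vector.span_base[of y "T ` B"] by blast
      ultimately show False
        using card B'(2) B(1) by simp
    qed
  qed
  also have "cspan (T ` B) = T ` S"
    using complex_vector_pair.linear_span_image[OF T, of B] B(4) unfolding cspan_def by simp
  finally show ?thesis
    using into by auto
qed

section \<open>Orthogonal and oblique projections\<close>

text \<open>
  One Gram-Schmidt step per generator: if \<open>q\<close> is the projection of the new generator \<open>b\<close> onto the
  old span, then \<open>b - q\<close> is orthogonal to that span, and the projection of \<open>v\<close> changes by a multiple
  of \<open>b - q\<close>.
\<close>

lemma ex_orthogonal_in_cspan:
  fixes v :: "'a::complex_hilbert_space"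
  assumes "finite B"
  shows "\<exists>p\<in>cspan B. \<forall>u\<in>cspan B. cinner u (v - p) = 0"
  using assms
proof (induction B arbitrary: v)
  case empty
  show ?case by (auto simp: complex_vector.span_empty)
next
  case (insert b B)
  obtain q where q: "q \<in> cspan B" "\<And>u. u \<in> cspan B \<Longrightarrow> cinner u (b - q) = 0"
    using insert.IH[of b] by blast
  obtain p where p: "p \<in> cspan B" "\<And>u. u \<in> cspan B \<Longrightarrow> cinner u (v - p) = 0"
    using insert.IH[of v] by blast
  \<comment> \<open>If \<open>b\<close> already lies in the old span, then \<open>b - q = 0\<close> and \<open>c = 0\<close> by division by zero.\<close>
  define c where "c = cinner (b - q) v / cinner (b - q) (b - q)"
  let ?w = "p + c *\<^sub>C (b - q)"
  have sub: "cspan B \<subseteq> cspan (insert b B)"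
    by (intro complex_vector.span_mono) auto
  have "b - q \<in> cspan (insert b B)"
    using q(1) sub complex_vector.span_base[of b "insert b B"]
    by (intro complex_vector.span_diff) auto
  then have w: "?w \<in> cspan (insert b B)"
    using p(1) sub by (intro complex_vector.span_add complex_vector.span_scale) auto
  have orthB: "cinner u (v - ?w) = 0" if "u \<in> cspan B" for u
    using p(2)[OF that] q(2)[OF that]
    by (simp add: cinner_diff_right cinner_add_right cinner_scaleC_right)
  have "cinner (b - q) p = 0"
    using q(2)[OF p(1)] cinner_eq_0_commute by blast
  then have orthb: "cinner (b - q) (v - ?w) = 0"
    by (cases "b - q = 0")
       (simp_all add: c_def cinner_diff_right[of _ v] cinner_add_right cinner_scaleC_right)
  have "cinner u (v - ?w) = 0" if "u \<in> cspan (insert b B)" for u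
  proof -
    obtain k where k: "u - k *\<^sub>C b \<in> cspan B"
      using \<open>u \<in> cspan (insert b B)\<close> complex_vector.span_breakdown_eq by blast
    have "cinner u x = cinner (u - k *\<^sub>C b + k *\<^sub>C q) x + cnj k * cinner (b - q) x" for x
      by (simp add: cinner_add_left cinner_diff_left cinner_scaleC_left algebra_simps)
    moreover have "u - k *\<^sub>C b + k *\<^sub>C q \<in> cspan B"
      using k q(1) by (intro complex_vector.span_add complex_vector.span_scale) auto
    ultimately show ?thesis
      using orthB orthb by simp
  qed
  with w show ?case by blast
qed

text \<open>
  The situation in which the oblique projection onto \<open>S1\<close> along the orthogonal complement of \<open>S2\<close> is
  defined on the whole space. The case \<open>S1 = S2\<close> is the orthogonal projection.
\<close>

locale oblique_pair =
  fixes S1 S2 :: "'a::complex_hilbert_space set"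
  assumes csubspace: "csubspace S1"
    and ex1: "\<exists>!w. w \<in> S1 \<and> (\<forall>u\<in>S2. cinner u (v - w) = 0)"
begin

abbreviation proj :: "'a \<Rightarrow> 'a" where "proj \<equiv> oblique_proj S1 S2"

lemma proj_in: "proj v \<in> S1"
  and proj_orthogonal: "u \<in> S2 \<Longrightarrow> cinner u (v - proj v) = 0"
  using theI'[OF ex1[of v]] unfolding oblique_proj_def by auto

lemma proj_eqI:
  assumes "w \<in> S1" "\<And>u. u \<in> S2 \<Longrightarrow> cinner u (v - w) = 0"
  shows "proj v = w"
  using assms ex1[of v] proj_in[of v] proj_orthogonal[of _ v] by blast

lemma proj_ident: "v \<in> S1 \<Longrightarrow> proj v = v"
  by (rule proj_eqI) auto

lemma clinear_proj: "clinear proj"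
proof (rule clinearI)
  show "proj (x + y) = proj x + proj y" for x y
    using proj_orthogonal[of _ x] proj_orthogonal[of _ y]
    by (intro proj_eqI complex_vector.subspace_add[OF csubspace] proj_in)
       (simp add: cinner_diff_right cinner_add_right)
  show "proj (c *\<^sub>C x) = c *\<^sub>C proj x" for c x
    using proj_orthogonal[of _ x]
    by (intro proj_eqI complex_vector.subspace_scale[OF csubspace] proj_in)
       (simp add: cinner_diff_right cinner_scaleC_right)
qed

end

lemma oblique_pair_orthogonal:
  assumes "has_cdim S n"
  shows "oblique_pair S S"
proof
  show S: "csubspace S" using assms by (rule has_cdim_csubspace)
  fix v
  obtain B where "finite B" "cspan B = S"
    using assms unfolding has_cdim_def by blast
  then obtain p where p: "p \<in> S" "\<And>u. u \<in> S \<Longrightarrow> cinner u (v - p) = 0"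
    using ex_orthogonal_in_cspan[of B v] by blast
  have "w = p" if w: "w \<in> S" "\<forall>u\<in>S. cinner u (v - w) = 0" for w
  proof -
    have "p - w \<in> S"
      using p(1) w(1) S by (intro complex_vector.subspace_diff)
    then have "cinner (p - w) (v - w) - cinner (p - w) (v - p) = 0"
      using p w by simp
    then have "cinner (p - w) (p - w) = 0"
      by (simp add: cinner_diff_right)
    then show ?thesis by simp
  qed
  with p show "\<exists>!w. w \<in> S \<and> (\<forall>u\<in>S. cinner u (v - w) = 0)"
    by blast
qed

lemma norm_orth_proj_le_dist:
  assumes "has_cdim S n" "y \<in> S"
  shows "norm (v - orth_proj S v) \<le> norm (y - v)"
proof -
  interpret oblique_pair S S using assms(1) by (rule oblique_pair_orthogonal)
  have "proj v - y \<in> S"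
    using proj_in assms(2) csubspace by (intro complex_vector.subspace_diff)
  then have "cinner (v - proj v) (proj v - y) = 0"
    using proj_orthogonal cinner_eq_0_commute[of "v - proj v"] by simp
  from norm_pythagoras_le[OF this] show ?thesis
    by (simp add: orth_proj_def norm_minus_commute)
qed

text \<open>
  Non-degeneracy says that the orthogonal projection onto \<open>S1\<close> is injective on \<open>S2\<close>. As the dimensions
  agree, it maps \<open>S2\<close> onto \<open>S1\<close>; hence no nonzero vector of \<open>S1\<close> is orthogonal to \<open>S2\<close>, which gives
  uniqueness. By the same token the orthogonal projection onto \<open>S2\<close> is injective on \<open>S1\<close>, hence maps \<open>S1\<close>
  onto \<open>S2\<close>, which gives existence: an \<open>s \<in> S1\<close> with the same projection onto \<open>S2\<close> as \<open>v\<close> is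
  the oblique projection of \<open>v\<close>.
\<close>

lemma oblique_pair_of_nondegenerate:
  assumes S1: "has_cdim S1 n" and S2: "has_cdim S2 n"
    and nondeg: "\<And>u. u \<in> S2 \<Longrightarrow> (\<And>v. v \<in> S1 \<Longrightarrow> cinner u v = 0) \<Longrightarrow> u = 0"
  shows "oblique_pair S1 S2"
proof
  interpret P1: oblique_pair S1 S1 using S1 by (rule oblique_pair_orthogonal)
  interpret P2: oblique_pair S2 S2 using S2 by (rule oblique_pair_orthogonal)
  show "csubspace S1" by (rule P1.csubspace)
  have "P1.proj ` S2 = S1"
  proof (rule injective_clinear_onto_of_same_dim[OF P1.clinear_proj S2 S1])
    show "u = 0" if "u \<in> S2" "P1.proj u = 0" for u
    proof (rule nondeg[OF \<open>u \<in> S2\<close>])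
      show "cinner u v = 0" if "v \<in> S1" for v
        using P1.proj_orthogonal[OF that, of u] \<open>P1.proj u = 0\<close> cinner_eq_0_commute[of u v]
        by simp
    qed
  qed (rule P1.proj_in)
  have zero: "s = 0" if s: "s \<in> S1" and orth: "\<And>u. u \<in> S2 \<Longrightarrow> cinner u s = 0" for s
  proof -
    obtain u where u: "u \<in> S2" "s = P1.proj u"
      using s \<open>P1.proj ` S2 = S1\<close> by blast
    have "cinner s (u - s) = 0"
      using P1.proj_orthogonal[OF s, of u] u by simp
    moreover have "cinner s u = 0"
      using orth[OF u(1)] cinner_eq_0_commute by blast
    ultimately show "s = 0" by (simp add: cinner_diff_right)
  qed
  have onto: "P2.proj ` S1 = S2"
  proof (rule injective_clinear_onto_of_same_dim[OF P2.clinear_proj S1 S2])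
    show "s = 0" if "s \<in> S1" "P2.proj s = 0" for s
      using zero[OF that(1)] P2.proj_orthogonal[of _ s] that(2) by simp
  qed (rule P2.proj_in)
  fix v
  obtain s where s: "s \<in> S1" "P2.proj v = P2.proj s"
    using onto P2.proj_in[of v] by (auto simp: image_iff)
  have orth: "cinner u (v - s) = 0" if "u \<in> S2" for u
    using P2.proj_orthogonal[OF that, of v] P2.proj_orthogonal[OF that, of s] s(2)
    by (simp add: cinner_diff_right)
  have "w = s" if w: "w \<in> S1" "\<forall>u\<in>S2. cinner u (v - w) = 0" for w
  proof -
    have "cinner u (w - s) = 0" if "u \<in> S2" for u
      using orth[OF that] w(2) that by (simp add: cinner_diff_right)
    then show ?thesis
      using zero[OF complex_vector.subspace_diff[OF P1.csubspace w(1) s(1)]] by simp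
  qed
  with s orth show "\<exists>!w. w \<in> S1 \<and> (\<forall>u\<in>S2. cinner u (v - w) = 0)"
    by blast
qed

lemma oblique_pair_of_inf_sup_pos:
  assumes S1: "has_cdim S1 n" and S2: "has_cdim S2 n"
    and pos: "inf_sup norm cinner S1 S2 > 0"
  shows "oblique_pair S1 S2"
proof (rule oblique_pair_of_nondegenerate[OF S1 S2], rule ccontr)
  fix u assume u: "u \<in> S2" "u \<noteq> 0" and orth: "\<And>v. v \<in> S1 \<Longrightarrow> cinner u v = 0"
  let ?e = "complex_of_real (1 / norm u) *\<^sub>C u"
  have "norm ?e = 1"
    using u(2) by (simp add: norm_divide)
  then have "?e \<in> {u \<in> S2. norm u = 1}"
    using complex_vector.subspace_scale[OF has_cdim_csubspace[OF S2] u(1)] by blast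
  then have "inf_sup norm cinner S1 S2 \<le> (SUP v\<in>{v \<in> S1. norm v = 1}. ennreal (cmod (cinner ?e v)))"
    unfolding inf_sup_def by (rule INF_lower)
  also have "\<dots> \<le> 0"
    by (intro SUP_least) (auto simp: cinner_scaleC_left orth)
  finally show False using pos by simp
qed

section \<open>Contour integrals of vector-valued functions over circles\<close>

lemma bounded_bilinear_scaleC:
  "bounded_bilinear (scaleC :: complex \<Rightarrow> 'a::complex_hilbert_space \<Rightarrow> 'a)"
  by (rule bounded_bilinear.intro)
     (auto simp: scaleC_add_left scaleC_add_right scaleR_scaleC scaleC_scaleC scaleR_conv_of_real
        mult.commute intro!: exI[of _ 1])

abbreviation circle_integrand ::
  "complex \<Rightarrow> real \<Rightarrow> (complex \<Rightarrow> 'a::complex_hilbert_space) \<Rightarrow> real \<Rightarrow> 'a" where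
  "circle_integrand c r f t \<equiv>
     vector_derivative (circlepath c r) (at t within {0..1}) *\<^sub>C f (circlepath c r t)"

lemma circlepath_in_sphere: "0 < r \<Longrightarrow> circlepath c r t \<in> sphere c r"
  by (simp add: circlepath dist_norm norm_mult)

lemma circle_integrand_integrable:
  assumes r: "0 < r" and f: "continuous_on (sphere c r) f"
  shows "circle_integrand c r f integrable_on {0..1}"
proof -
  have "continuous_on {0..1} (\<lambda>t. (2 * pi * \<i> * r * exp (2 * of_real pi * \<i> * of_real t)) *\<^sub>C
      f (circlepath c r t))"
  proof (rule bounded_bilinear.continuous_on[OF bounded_bilinear_scaleC])
    show "continuous_on {0..1} (\<lambda>t. f (circlepath c r t))"
      using circlepath_in_sphere[OF r]
      by (intro continuous_on_compose2[OF f]) (auto simp: circlepath intro!: continuous_intros)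
  qed (intro continuous_intros)
  then have "(\<lambda>t. (2 * pi * \<i> * r * exp (2 * of_real pi * \<i> * of_real t)) *\<^sub>C
      f (circlepath c r t)) integrable_on {0..1}"
    by (rule integrable_continuous_interval)
  then show ?thesis
    by (rule integrable_eq) (simp add: vector_derivative_circlepath01)
qed

lemma norm_circle_integral_le:
  assumes r: "0 < r" and "0 \<le> B"
    and int: "(circle_integrand c r f has_integral I) {0..1}"
    and le: "\<And>z. z \<in> sphere c r \<Longrightarrow> norm (f z) \<le> B"
  shows "norm I \<le> 2 * pi * r * B"
proof -
  have "norm I \<le> (2 * pi * r * B) * measure lborel {0..1::real}"
  proof (rule has_integral_bound_real[OF _ finite.emptyI int])
    show "norm (circle_integrand c r f t) \<le> 2 * pi * r * B" if "t \<in> {0..1} - {}" for t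
      using that r le[OF circlepath_in_sphere[OF r, of c t]]
      by (simp add: vector_derivative_circlepath01 norm_mult mult_left_mono)
  qed (use r \<open>0 \<le> B\<close> in simp)
  then show ?thesis by simp
qed

text \<open>
  Cauchy's formula for the \<open>k\<close>-th derivative of the constant function \<open>1\<close> at the centre, multiplied by
  a fixed vector.
\<close>

lemma has_integral_circle_inverse_power:
  assumes "0 < r"
  shows "(circle_integrand c r (\<lambda>z. (1 / (z - c) ^ Suc k) *\<^sub>C x)
            has_integral (if k = 0 then (2 * of_real pi * \<i>) *\<^sub>C x else 0)) {0..1}"
proof -
  have "((\<lambda>z. 1 / (z - c) ^ Suc k) has_contour_integral
          2 * pi * \<i> / fact k * (deriv ^^ k) (\<lambda>_. 1) c) (circlepath c r)"
    using assms by (intro Cauchy_has_contour_integral_higher_derivative_circlepath) auto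
  then have "((\<lambda>t. 1 / (circlepath c r t - c) ^ Suc k *
        vector_derivative (circlepath c r) (at t within {0..1}))
      has_integral 2 * pi * \<i> / fact k * (deriv ^^ k) (\<lambda>_. 1) c) {0..1}"
    unfolding has_contour_integral_def .
  from has_integral_linear[OF this
      bounded_bilinear.bounded_linear_left[OF bounded_bilinear_scaleC, of x]]
  show ?thesis
    by (cases "k = 0") (simp_all add: o_def scaleC_scaleC mult.commute higher_deriv_const)
qed

section \<open>Resolvents\<close>

lemma clinear_funpow:
  fixes T :: "'a::complex_hilbert_space \<Rightarrow> 'a"
  shows "clinear T \<Longrightarrow> clinear (T ^^ k)"
proof (induction k)
  case 0
  show ?case by (rule clinearI) auto
next
  case (Suc k)
  then show ?case
    by (intro clinearI) (simp_all add: clinear_add clinear_scale)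
qed

text \<open>
  The Neumann series of \<open>(\<zeta> - T)\<inverse>\<close> at \<open>u\<close> terminates when a power of \<open>T\<close> kills \<open>u\<close>. With
  \<open>T = A - \<mu>\<close> and \<open>\<zeta> = z - \<mu>\<close> it exhibits \<open>(z - A)\<inverse> u\<close>, for a generalized eigenvector \<open>u\<close>, as a
  Laurent polynomial in \<open>z - \<mu>\<close> whose coefficients are generalized eigenvectors.
\<close>

lemma nilpotent_resolvent_series:
  fixes T :: "'a::complex_hilbert_space \<Rightarrow> 'a"
  assumes T: "clinear T" and nil: "(T ^^ k) u = 0" and \<zeta>: "\<zeta> \<noteq> 0"
    and w: "w = (\<Sum>j<k. (1 / \<zeta> ^ Suc j) *\<^sub>C (T ^^ j) u)"
  shows "\<zeta> *\<^sub>C w - T w = u" and "(T ^^ k) w = 0"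
proof -
  have "\<zeta> *\<^sub>C w - T w = (\<Sum>j<k. (1 / \<zeta> ^ j) *\<^sub>C (T ^^ j) u - (1 / \<zeta> ^ Suc j) *\<^sub>C (T ^^ Suc j) u)"
    using \<zeta> by (simp add: w clinear_sum[OF T] clinear_scale[OF T] complex_vector.scale_sum_right
        scaleC_scaleC sum_subtractf)
  also have "\<dots> = u - (1 / \<zeta> ^ k) *\<^sub>C (T ^^ k) u"
    using sum_lessThan_telescope'[of "\<lambda>j. (1 / \<zeta> ^ j) *\<^sub>C (T ^^ j) u" k] by simp
  finally show "\<zeta> *\<^sub>C w - T w = u"
    using nil by simp
  have "(T ^^ k) ((T ^^ j) u) = 0" for j
    using nil clinear_0[OF clinear_funpow[OF T]] by (metis comp_apply funpow_add add.commute)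
  then show "(T ^^ k) w = 0"
    by (simp add: w clinear_sum[OF clinear_funpow[OF T]] clinear_scale[OF clinear_funpow[OF T]])
qed

lemma lower_bound_off_spectrum:
  assumes "z \<notin> spectrum A"
  shows "\<exists>\<gamma>>0. \<forall>y. \<gamma> * norm y \<le> norm (z *\<^sub>C y - A y)"
proof -
  have bij: "bij (\<lambda>x. z *\<^sub>C x - A x)" and bl: "bounded_linear (resolvent A z)"
    using assms by (auto simp: spectrum_def)
  obtain K where K: "0 < K" "\<And>x. norm (resolvent A z x) \<le> norm x * K"
    using bounded_linear.pos_bounded[OF bl] by blast
  have "norm y \<le> norm (z *\<^sub>C y - A y) * K" for y
    using K(2)[of "z *\<^sub>C y - A y"] inv_f_f[OF bij_is_inj[OF bij], of y]
    by (simp add: resolvent_def)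
  then have "\<forall>y. 1 / K * norm y \<le> norm (z *\<^sub>C y - A y)"
    using K(1) by (simp add: field_simps)
  with K(1) show ?thesis by (intro exI[of _ "1 / K"]) simp
qed

text \<open>
  A lower bound with constant \<open>\<gamma>\<close> at \<open>c\<close> persists with constant \<open>\<gamma> / 2\<close> on the ball of radius \<open>\<gamma> / 2\<close>
  around \<open>c\<close>, and finitely many such balls cover \<open>K\<close>.
\<close>

lemma uniform_lower_bound_off_spectrum:
  assumes "compact K" "K \<inter> spectrum A = {}"
  shows "\<exists>\<gamma>>0. \<forall>z\<in>K. \<forall>y. \<gamma> * norm y \<le> norm (z *\<^sub>C y - A y)"
proof -
  have "\<forall>z\<in>K. \<exists>\<gamma>>0. \<forall>y. \<gamma> * norm y \<le> norm (z *\<^sub>C y - A y)"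
    using assms(2) lower_bound_off_spectrum by blast
  then obtain g where g: "\<And>z. z \<in> K \<Longrightarrow> g z > 0"
    "\<And>z y. z \<in> K \<Longrightarrow> g z * norm y \<le> norm (z *\<^sub>C y - A y)"
    by metis
  obtain D where D: "D \<subseteq> K" "finite D" "K \<subseteq> (\<Union>c\<in>D. ball c (g c / 2))"
    using compactE_image[OF assms(1), of K "\<lambda>c. ball c (g c / 2)"] g(1) by force
  define \<gamma> where "\<gamma> = Min (insert 1 (g ` D)) / 2"
  have "\<gamma> > 0"
    using D g(1) by (auto simp: \<gamma>_def)
  moreover have "\<gamma> * norm y \<le> norm (z *\<^sub>C y - A y)" if z: "z \<in> K" for z y
  proof -
    obtain c where c: "c \<in> D" "cmod (c - z) < g c / 2"
      using D(3) z by (auto simp: dist_norm)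
    have eq: "(z *\<^sub>C y - A y) + (c - z) *\<^sub>C y = c *\<^sub>C y - A y"
      by (simp add: complex_vector.scale_left_diff_distrib)
    have "g c * norm y \<le> norm (c *\<^sub>C y - A y)"
      using g(2) c(1) D(1) by blast
    also have "\<dots> \<le> norm (z *\<^sub>C y - A y) + cmod (c - z) * norm y"
      using norm_triangle_ineq[of "z *\<^sub>C y - A y" "(c - z) *\<^sub>C y"] unfolding eq by simp
    also have "\<dots> \<le> norm (z *\<^sub>C y - A y) + g c / 2 * norm y"
      using c(2) by (intro add_left_mono mult_right_mono) auto
    finally have "g c / 2 * norm y \<le> norm (z *\<^sub>C y - A y)" by simp
    moreover have "\<gamma> \<le> g c / 2"
      using D(2) c(1) by (auto simp: \<gamma>_def)
    then have "\<gamma> * norm y \<le> g c / 2 * norm y"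
      by (intro mult_right_mono) auto
    ultimately show ?thesis by linarith
  qed
  ultimately show ?thesis by blast
qed

text \<open>
  A small gap forces a lower bound for \<open>z - A\<close> upon \<open>z - L\<close>: every \<open>x \<in> S\<close> has a \<open>y\<close> such that
  \<open>(y, A y)\<close> is close to \<open>(x, L x)\<close>, so that \<open>z y - A y\<close> is close to \<open>z x - L x\<close>. The gap
  measures closeness relative to \<open>norm x + norm (L x)\<close>; since \<open>norm (L x)\<close> is at most
  \<open>\<bar>z\<bar> norm x + norm (z x - L x)\<close>, the resulting error can be absorbed on both sides.
  The constants depend on \<open>\<gamma>\<close> and on a bound for \<open>\<bar>z\<bar>\<close>, but not on \<open>S\<close> or \<open>L\<close>.
\<close>

lemma lower_bound_of_operator_gap:
  assumes \<gamma>: "0 < \<gamma>" "\<And>y. \<gamma> * norm y \<le> norm (z *\<^sub>C y - A y)"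
    and z: "cmod z \<le> \<rho>"
    and gap: "operator_gap S L UNIV A < ennreal (\<gamma> / (2 * (1 + \<rho> + \<gamma>)\<^sup>2))"
    and x: "x \<in> S"
  shows "\<gamma> / 4 * norm x \<le> norm (z *\<^sub>C x - L x)"
proof (cases "x = 0")
  case True
  then show ?thesis by simp
next
  case False
  define K where "K = 1 + \<rho> + \<gamma>"
  \<comment> \<open>With \<open>p = norm (z x - L x)\<close> the error is at most \<open>K d (K norm x + p)\<close>, and \<open>d\<close> makes \<open>d K\<^sup>2 = \<gamma> / 2\<close> and \<open>d K \<le> 1\<close>.\<close>
  define d where "d = \<gamma> / (2 * K\<^sup>2)"
  have K: "K \<ge> 1" "K \<ge> \<gamma>" "1 + cmod z + \<gamma> \<le> K"
    using \<gamma>(1) z norm_ge_zero[of z] by (auto simp: K_def simp del: norm_ge_zero)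
  have d0: "d > 0" using \<gamma>(1) K(1) by (simp add: d_def)
  let ?n = "norm x + norm (L x)"
  have n: "?n > 0" using False by (simp add: add_pos_nonneg)
  have "(INF y. ennreal (norm (x - y) + norm (L x - A y))) / ennreal ?n \<le> operator_gap S L UNIV A"
    unfolding operator_gap_def using x False by (intro SUP_upper) auto
  also have "\<dots> < ennreal d"
    using gap by (simp add: d_def K_def)
  finally have "(INF y. ennreal (norm (x - y) + norm (L x - A y))) < ennreal d * ennreal ?n"
    using n by (subst (asm) divide_less_ennreal) auto
  then obtain y where "ennreal (norm (x - y) + norm (L x - A y)) < ennreal d * ennreal ?n"
    by (auto simp: INF_less_iff)
  then have e: "norm (x - y) + norm (L x - A y) < d * ?n"
    unfolding ennreal_mult[OF less_imp_le[OF d0] less_imp_le[OF n], symmetric]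
    by (subst (asm) ennreal_less_iff) auto
  let ?p = "norm (z *\<^sub>C x - L x)"
  have "L x = z *\<^sub>C x - (z *\<^sub>C x - L x)" by simp
  then have Lx: "norm (L x) \<le> cmod z * norm x + ?p"
    by (metis norm_scaleC norm_triangle_ineq4)
  have "norm (z *\<^sub>C y - A y) \<le> ?p + (1 + cmod z) * (norm (x - y) + norm (L x - A y))"
  proof -
    have "z *\<^sub>C y - A y = (z *\<^sub>C x - L x) + (- (z *\<^sub>C (x - y)) + (L x - A y))"
      by (simp add: complex_vector.scale_right_diff_distrib)
    then have "norm (z *\<^sub>C y - A y) \<le> ?p + (norm (- (z *\<^sub>C (x - y))) + norm (L x - A y))"
      by (metis norm_triangle_le add_left_mono norm_triangle_ineq)
    also have "\<dots> = ?p + (cmod z * norm (x - y) + 1 * norm (L x - A y))"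
      by (simp only: norm_minus_cancel norm_scaleC mult_1)
    also have "\<dots> \<le> ?p + ((1 + cmod z) * norm (x - y) + (1 + cmod z) * norm (L x - A y))"
      by (intro add_mono mult_right_mono) auto
    also have "\<dots> = ?p + (1 + cmod z) * (norm (x - y) + norm (L x - A y))"
      by (simp only: distrib_left)
    finally show ?thesis .
  qed
  moreover have "\<gamma> * norm x \<le> \<gamma> * norm y + \<gamma> * (norm (x - y) + norm (L x - A y))"
    using \<gamma>(1) norm_triangle_sub[of x y]
    by (simp flip: distrib_left) (smt (verit) norm_ge_zero)
  ultimately have "\<gamma> * norm x \<le> ?p + (1 + cmod z + \<gamma>) * (norm (x - y) + norm (L x - A y))"
    using \<gamma>(2)[of y] by (simp add: algebra_simps)
  also have "\<dots> \<le> ?p + K * (d * ?n)"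
    using e K \<gamma>(1) by (intro add_left_mono mult_mono) auto
  also have "\<dots> \<le> ?p + K * (d * (K * norm x + ?p))"
  proof -
    have "(1 + cmod z) * norm x \<le> K * norm x"
      using K(3) \<gamma>(1) by (intro mult_right_mono) auto
    then have "?n \<le> K * norm x + ?p" using Lx by (simp add: algebra_simps)
    then show ?thesis
      using K(1) d0 by (intro add_left_mono mult_left_mono) auto
  qed
  also have "\<dots> = ?p + (d * K\<^sup>2) * norm x + (d * K) * ?p"
    by (simp add: algebra_simps power2_eq_square)
  also have "\<dots> \<le> ?p + \<gamma> / 2 * norm x + 1 * ?p"
  proof (intro add_mono mult_right_mono)
    show "d * K\<^sup>2 \<le> \<gamma> / 2" using K(1) by (simp add: d_def)
    have "d * K = \<gamma> / (2 * K)"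
      using K(1) by (simp add: d_def power2_eq_square)
    also have "\<dots> \<le> 1"
      using K(1,2) by (simp add: divide_simps)
    finally show "d * K \<le> 1" .
  qed auto
  finally show ?thesis by simp
qed

section \<open>The Galerkin resolvent and the spectral projections\<close>

locale galerkin = oblique_pair S1 S2
  for S1 S2 :: "'a::complex_hilbert_space set" +
  fixes A :: "'a \<Rightarrow> 'a" and n :: nat
  assumes dim: "has_cdim S1 n" and clinear_A: "clinear A"
begin

abbreviation Ah :: "'a \<Rightarrow> 'a" where "Ah \<equiv> galerkin_op A S1 S2"

lemma Ah_eq: "Ah x = proj (A (proj x))"
  by (simp add: galerkin_op_def)

lemma clinear_Ah: "clinear Ah"
  by (rule clinearI)
     (simp_all add: Ah_eq clinear_add[OF clinear_proj] clinear_add[OF clinear_A]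
       clinear_scale[OF clinear_proj] clinear_scale[OF clinear_A])

lemma shifted_Ah_onto:
  assumes "0 < \<gamma>" and lower: "\<And>x. x \<in> S1 \<Longrightarrow> \<gamma> * norm x \<le> norm (z *\<^sub>C x - Ah x)"
  shows "(\<lambda>x. z *\<^sub>C x - Ah x) ` S1 = S1"
proof (rule injective_clinear_onto_of_same_dim[OF _ dim dim])
  show "clinear (\<lambda>x. z *\<^sub>C x - Ah x)"
    by (rule clinearI)
       (simp_all add: clinear_add[OF clinear_Ah] clinear_scale[OF clinear_Ah] scaleC_add_right
          complex_vector.scale_right_diff_distrib scaleC_scaleC mult.commute)
  show "z *\<^sub>C x - Ah x \<in> S1" if "x \<in> S1" for x
    using that csubspace
    by (intro complex_vector.subspace_diff complex_vector.subspace_scale) (auto simp: Ah_eq proj_in)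
  show "x = 0" if "x \<in> S1" "z *\<^sub>C x - Ah x = 0" for x
    using lower[OF that(1)] that(2) \<open>0 < \<gamma>\<close> by (simp add: mult_le_0_iff)
qed

text \<open>
  The operator \<open>Ah\<close> has range in \<open>S1\<close> and vanishes on the kernel of the projection. On the whole space
  \<open>z - Ah\<close> is therefore the direct sum of its restriction to \<open>S1\<close> and of \<open>z\<close> times the identity on that
  kernel, which is why \<open>z \<noteq> 0\<close> is required.
\<close>

lemma bij_shifted_Ah:
  assumes "z \<noteq> 0" "0 < \<gamma>" and lower: "\<And>x. x \<in> S1 \<Longrightarrow> \<gamma> * norm x \<le> norm (z *\<^sub>C x - Ah x)"
  shows "bij (\<lambda>x. z *\<^sub>C x - Ah x)"
proof (rule bijI)
  show "inj (\<lambda>x. z *\<^sub>C x - Ah x)"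
  proof (rule injI)
    fix x y assume "z *\<^sub>C x - Ah x = z *\<^sub>C y - Ah y"
    then have eq: "z *\<^sub>C (x - y) - Ah (x - y) = 0"
      by (simp add: complex_vector.scale_right_diff_distrib clinear_diff[OF clinear_Ah] algebra_simps)
    then have "x - y = (1 / z) *\<^sub>C Ah (x - y)"
      using \<open>z \<noteq> 0\<close> by (metis complex_vector.scale_left_imp_eq complex_vector.scale_one
          eq_iff_diff_eq_0 nonzero_eq_divide_eq scaleC_scaleC mult.commute)
    moreover have "(1 / z) *\<^sub>C Ah (x - y) \<in> S1"
      using complex_vector.subspace_scale[OF csubspace proj_in] by (simp add: Ah_eq)
    ultimately have "x - y \<in> S1" by simp
    then show "x = y"
      using lower[of "x - y"] eq \<open>0 < \<gamma>\<close> by (simp add: mult_le_0_iff)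
  qed
  show "surj (\<lambda>x. z *\<^sub>C x - Ah x)"
    unfolding surj_def
  proof
    fix v
    obtain s where s: "s \<in> S1" "proj v = z *\<^sub>C s - Ah s"
      using shifted_Ah_onto[OF assms(2,3)] proj_in[of v] by (metis (no_types, lifting) imageE)
    let ?k = "(1 / z) *\<^sub>C (v - proj v)"
    have "Ah ?k = 0"
      by (simp add: Ah_eq clinear_scale[OF clinear_proj] clinear_diff[OF clinear_proj]
          proj_ident[OF proj_in] clinear_0[OF clinear_A] clinear_0[OF clinear_proj]
          del: complex_vector.scale_right_diff_distrib)
    then have "Ah (s + ?k) = Ah s"
      by (simp only: clinear_add[OF clinear_Ah] add_0_right)
    moreover have "z *\<^sub>C (s + ?k) = z *\<^sub>C s + (v - proj v)"
      using \<open>z \<noteq> 0\<close> by (simp add: scaleC_add_right scaleC_scaleC)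
    ultimately have "v = z *\<^sub>C (s + ?k) - Ah (s + ?k)"
      using s(2) by simp
    then show "\<exists>x. v = z *\<^sub>C x - Ah x" ..
  qed
qed

lemma Ah_resolvent:
  assumes "z \<noteq> 0" "0 < \<gamma>" and lower: "\<And>x. x \<in> S1 \<Longrightarrow> \<gamma> * norm x \<le> norm (z *\<^sub>C x - Ah x)"
    and s: "s \<in> S1"
  shows "resolvent Ah z s \<in> S1"
    and "z *\<^sub>C resolvent Ah z s - Ah (resolvent Ah z s) = s"
    and "\<gamma> * norm (resolvent Ah z s) \<le> norm s"
proof -
  note bij = bij_shifted_Ah[OF assms(1-3)]
  obtain x where x: "x \<in> S1" "s = z *\<^sub>C x - Ah x"
    using shifted_Ah_onto[OF assms(2,3)] s by (metis (no_types, lifting) imageE)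
  have "resolvent Ah z s = x"
    unfolding resolvent_def x(2) using inv_f_f[OF bij_is_inj[OF bij], of x] by simp
  with x lower[OF x(1)] show "resolvent Ah z s \<in> S1"
    "z *\<^sub>C resolvent Ah z s - Ah (resolvent Ah z s) = s"
    "\<gamma> * norm (resolvent Ah z s) \<le> norm s" by simp_all
qed

text \<open>
  The resolvent identity makes \<open>z \<mapsto> (z - Ah)\<inverse> s\<close> Lipschitz continuous. This is needed because the
  integral in the spectral projection would be \<open>0\<close> by convention if the integrand were not integrable.
\<close>

lemma continuous_on_Ah_resolvent:
  assumes K: "0 \<notin> K" "0 < \<gamma>"
    and lower: "\<And>z x. z \<in> K \<Longrightarrow> x \<in> S1 \<Longrightarrow> \<gamma> * norm x \<le> norm (z *\<^sub>C x - Ah x)"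
    and s: "s \<in> S1"
  shows "continuous_on K (\<lambda>z. resolvent Ah z s)"
proof -
  let ?R = "\<lambda>z. resolvent Ah z s"
  have R: "?R z \<in> S1" "z *\<^sub>C ?R z - Ah (?R z) = s" "\<gamma> * norm (?R z) \<le> norm s" if "z \<in> K" for z
    using that K(1) Ah_resolvent[OF _ K(2) lower[OF that] s] by auto
  have "dist (?R z) (?R w) \<le> norm s / \<gamma>\<^sup>2 * dist z w" if z: "z \<in> K" and w: "w \<in> K" for z w
  proof -
    have "z *\<^sub>C (?R z - ?R w) - Ah (?R z - ?R w) =
        (z *\<^sub>C ?R z - Ah (?R z)) - (w *\<^sub>C ?R w - Ah (?R w)) + (w - z) *\<^sub>C ?R w"
      by (simp add: clinear_diff[OF clinear_Ah] complex_vector.scale_right_diff_distrib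
          complex_vector.scale_left_diff_distrib)
    also have "\<dots> = (w - z) *\<^sub>C ?R w"
      by (simp add: R(2)[OF z] R(2)[OF w])
    finally have "\<gamma> * norm (?R z - ?R w) \<le> dist z w * norm (?R w)"
      using lower[OF z complex_vector.subspace_diff[OF csubspace R(1)[OF z] R(1)[OF w]]]
      by (simp add: dist_norm norm_minus_commute)
    then have "\<gamma> * (\<gamma> * norm (?R z - ?R w)) \<le> \<gamma> * (dist z w * norm (?R w))"
      using K(2) by (intro mult_left_mono) auto
    also have "\<gamma> * (dist z w * norm (?R w)) = dist z w * (\<gamma> * norm (?R w))"
      by (simp add: mult.left_commute)
    also have "\<dots> \<le> dist z w * norm s"
      using R(3)[OF w] by (intro mult_left_mono) auto
    finally show ?thesis
      using K(2) by (simp add: dist_norm power2_eq_square field_simps)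
  qed
  then have "(norm s / \<gamma>\<^sup>2)-lipschitz_on K ?R"
    using K(2) by (intro lipschitz_onI) auto
  then show ?thesis by (rule lipschitz_on_continuous_on)
qed

text \<open>
  Let \<open>w z = (z - A)\<inverse> u\<close>. From
  \<open>(z - Ah) proj (w z) = proj u + proj (A (w z - proj (w z)))\<close> one obtains
  \<open>(z - Ah)\<inverse> (proj u) - proj (w z) = - (z - Ah)\<inverse> (proj (A (w z - proj (w z))))\<close>,
  so the difference of the two integrands is controlled by the consistency error \<open>\<eta>\<close> at the generalized
  eigenvector \<open>w z\<close>. Integrated over the circle, the first term gives the discrete spectral projection of
  \<open>proj u\<close>, and the second gives \<open>proj u\<close> itself, since only the residue of the Laurent polynomial
  \<open>w z\<close> survives.
\<close>

lemma riesz_projection_error: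
  assumes r: "0 < r" and nz: "0 \<notin> sphere \<mu> r"
    and \<gamma>: "0 < \<gamma>" "\<And>z y. z \<in> sphere \<mu> r \<Longrightarrow> \<gamma> * norm y \<le> norm (z *\<^sub>C y - A y)"
    and \<gamma>': "0 < \<gamma>'"
      "\<And>z x. z \<in> sphere \<mu> r \<Longrightarrow> x \<in> S1 \<Longrightarrow> \<gamma>' * norm x \<le> norm (z *\<^sub>C x - Ah x)"
    and u: "u \<in> gen_eigenspace A \<mu>"
    and \<eta>: "0 \<le> \<eta>"
      "\<And>w. w \<in> gen_eigenspace A \<mu> \<Longrightarrow> norm (proj (A (w - proj w))) \<le> \<eta> * norm w"
  shows "norm (riesz_projection Ah \<mu> r (proj u) - proj u) \<le> r / (\<gamma> * \<gamma>') * \<eta> * norm u"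
proof -
  define T where "T = (\<lambda>x. A x - \<mu> *\<^sub>C x)"
  have T: "clinear T"
    unfolding T_def
    by (rule clinearI)
       (simp_all add: clinear_add[OF clinear_A] clinear_scale[OF clinear_A] scaleC_add_right
          complex_vector.scale_right_diff_distrib scaleC_scaleC mult.commute)
  obtain k where k: "1 \<le> k" "(T ^^ k) u = 0"
    using u unfolding gen_eigenspace_def T_def by auto
  define w where "w z = (\<Sum>j<k. (1 / (z - \<mu>) ^ Suc j) *\<^sub>C (T ^^ j) u)" for z
  have ne: "z - \<mu> \<noteq> 0" if "z \<in> sphere \<mu> r" for z
    using that r by (auto simp: dist_norm)
  have w: "z *\<^sub>C w z - A (w z) = u" "w z \<in> gen_eigenspace A \<mu>" if "z \<in> sphere \<mu> r" for z
  proof -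
    note N = nilpotent_resolvent_series[OF T k(2) ne[OF that] w_def]
    show "z *\<^sub>C w z - A (w z) = u"
      using N(1) by (simp add: T_def complex_vector.scale_left_diff_distrib)
    show "w z \<in> gen_eigenspace A \<mu>"
      using N(2) k(1) unfolding gen_eigenspace_def T_def by auto
  qed
  let ?I = "circle_integrand \<mu> r"
  let ?R = "\<lambda>z. resolvent Ah z (proj u)"
  have projw: "proj (w z) = (\<Sum>j<k. (1 / (z - \<mu>) ^ Suc j) *\<^sub>C proj ((T ^^ j) u))" for z
    by (simp add: w_def clinear_sum[OF clinear_proj] clinear_scale[OF clinear_proj])
  have "((\<lambda>t. \<Sum>j<k. ?I (\<lambda>z. (1 / (z - \<mu>) ^ Suc j) *\<^sub>C proj ((T ^^ j) u)) t) has_integral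
      (\<Sum>j<k. if j = 0 then (2 * of_real pi * \<i>) *\<^sub>C proj ((T ^^ j) u) else 0)) {0..1}"
    by (intro has_integral_sum has_integral_circle_inverse_power[OF r]) auto
  moreover have "(\<Sum>j<k. if j = 0 then (2 * of_real pi * \<i>) *\<^sub>C proj ((T ^^ j) u) else 0)
      = (2 * of_real pi * \<i>) *\<^sub>C proj u"
    using k(1) by (subst sum.delta) auto
  ultimately have intw: "(?I (\<lambda>z. proj (w z)) has_integral (2 * of_real pi * \<i>) *\<^sub>C proj u) {0..1}"
    by (simp add: projw complex_vector.scale_sum_right)
  have "?I ?R integrable_on {0..1}"
    by (intro circle_integrand_integrable[OF r]
        continuous_on_Ah_resolvent[OF nz \<gamma>'(1) \<gamma>'(2) proj_in])
  then have intR: "(?I ?R has_integral vec_contour_integral (circlepath \<mu> r) ?R) {0..1}"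
    unfolding vec_contour_integral_def by (rule integrable_integral)
  let ?J = "vec_contour_integral (circlepath \<mu> r) ?R - (2 * of_real pi * \<i>) *\<^sub>C proj u"
  have "(?I (\<lambda>z. ?R z - proj (w z)) has_integral ?J) {0..1}"
    using has_integral_diff[OF intR intw] by (simp add: complex_vector.scale_right_diff_distrib)
  then have J: "norm ?J \<le> 2 * pi * r * (\<eta> * norm u / (\<gamma> * \<gamma>'))"
  proof (rule norm_circle_integral_le[OF r, rotated])
    show "0 \<le> \<eta> * norm u / (\<gamma> * \<gamma>')"
      using \<eta>(1) \<gamma>(1) \<gamma>'(1) by simp
    fix z assume z: "z \<in> sphere \<mu> r"
    then have "z \<noteq> 0" using nz by auto
    note R = Ah_resolvent[OF this \<gamma>'(1) \<gamma>'(2)[OF z] proj_in]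
    have "proj u = z *\<^sub>C proj (w z) - proj (A (w z))"
      using w(1)[OF z] clinear_diff[OF clinear_proj] clinear_scale[OF clinear_proj] by metis
    then have "z *\<^sub>C (?R z - proj (w z)) - Ah (?R z - proj (w z)) = - proj (A (w z - proj (w z)))"
      using R(2)[of u]
      by (simp add: clinear_diff[OF clinear_Ah] complex_vector.scale_right_diff_distrib
          clinear_diff[OF clinear_A] clinear_diff[OF clinear_proj] Ah_eq[of "proj _"]
          proj_ident[OF proj_in] algebra_simps)
    then have "\<gamma>' * norm (?R z - proj (w z)) \<le> norm (proj (A (w z - proj (w z))))"
      using \<gamma>'(2)[OF z complex_vector.subspace_diff[OF csubspace R(1) proj_in], of u "w z"] by simp
    also have "\<dots> \<le> \<eta> * norm (w z)"
      by (rule \<eta>(2)[OF w(2)[OF z]])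
    finally have "\<gamma> * (\<gamma>' * norm (?R z - proj (w z))) \<le> \<gamma> * (\<eta> * norm (w z))"
      using \<gamma>(1) by (intro mult_left_mono) auto
    also have "\<dots> = \<eta> * (\<gamma> * norm (w z))"
      by (simp add: mult.left_commute)
    also have "\<dots> \<le> \<eta> * norm u"
      using \<gamma>(2)[OF z, of "w z"] w(1)[OF z] \<eta>(1) by (intro mult_left_mono) auto
    finally show "norm (?R z - proj (w z)) \<le> \<eta> * norm u / (\<gamma> * \<gamma>')"
      using \<gamma>(1) \<gamma>'(1) by (simp add: field_simps)
  qed
  have "riesz_projection Ah \<mu> r (proj u) - proj u = (1 / (2 * of_real pi * \<i>)) *\<^sub>C ?J"
    by (simp add: riesz_projection_def complex_vector.scale_right_diff_distrib scaleC_scaleC)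
  then have "norm (riesz_projection Ah \<mu> r (proj u) - proj u) = 1 / (2 * pi) * norm ?J"
    by (simp only: norm_scaleC) (simp add: norm_divide norm_mult)
  also have "\<dots> \<le> 1 / (2 * pi) * (2 * pi * r * (\<eta> * norm u / (\<gamma> * \<gamma>')))"
    using J by (intro mult_left_mono) auto
  also have "\<dots> = r / (\<gamma> * \<gamma>') * \<eta> * norm u"
    by simp
  finally show ?thesis .
qed

text \<open>
  The right-hand side may be the product of \<open>\<infinity>\<close> and \<open>0\<close>, which counts as \<open>0\<close>. The bound is then
  still correct: a vanishing distance from \<open>w\<close> to \<open>S1\<close> means \<open>w \<in> S1\<close>, so that the left-hand side
  vanishes as well.
\<close>

lemma consistency_error_le:
  assumes w: "w \<in> U"
  shows "ennreal (norm (proj (A (w - proj w))))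
           \<le> galerkin_eps A U S1 S2 * subspace_gap U S1 * ennreal (norm w)"
proof (cases "w - orth_proj S1 w = 0")
  case True
  interpret P: oblique_pair S1 S1 using dim by (rule oblique_pair_orthogonal)
  have "w \<in> S1"
    using True P.proj_in[of w] by (simp add: orth_proj_def)
  then show ?thesis
    by (simp add: proj_ident clinear_0[OF clinear_A] clinear_0[OF clinear_proj])
next
  case False
  let ?d = "norm (w - orth_proj S1 w)"
  have "w \<noteq> 0"
  proof
    assume "w = 0"
    then show False
      using False norm_orth_proj_le_dist[OF dim complex_vector.subspace_0[OF csubspace], of 0] by simp
  qed
  have "ennreal ?d \<le> (INF y\<in>S1. ennreal (norm (y - w)))"
    by (intro INF_greatest ennreal_leI norm_orth_proj_le_dist[OF dim])
  also have "\<dots> = (INF y\<in>S1. ennreal (norm (y - w))) / ennreal (norm w) * ennreal (norm w)"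
    using \<open>w \<noteq> 0\<close> by (simp add: ennreal_divide_times)
  also have "\<dots> \<le> subspace_gap U S1 * ennreal (norm w)"
    unfolding subspace_gap_def using w \<open>w \<noteq> 0\<close> by (intro mult_right_mono SUP_upper) auto
  finally have d: "ennreal ?d \<le> subspace_gap U S1 * ennreal (norm w)" .
  have "ennreal (norm (proj (A (w - proj w)))) =
      ennreal (norm (proj (A (w - proj w)))) / ennreal ?d * ennreal ?d"
    using False by (simp add: ennreal_divide_times)
  also have "\<dots> \<le> galerkin_eps A U S1 S2 * ennreal ?d"
    unfolding galerkin_eps_def using w by (intro mult_right_mono SUP_upper) auto
  also have "\<dots> \<le> galerkin_eps A U S1 S2 * (subspace_gap U S1 * ennreal (norm w))"
    using d by (intro mult_left_mono) auto
  finally show ?thesis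
    by (simp add: mult.assoc)
qed

end

section \<open>The error estimate\<close>

text \<open>
  Linearity is not part of the definition of an associated operator; it is inherited from the form because
  inner products with all vectors determine a vector.
\<close>

lemma associated_operator_clinear:
  assumes "sesquilinear_on V a" "associated_operator V a A" "op_dom V a = UNIV"
  shows "clinear A"
proof -
  have V: "V = UNIV" using assms(3) by (auto simp: op_dom_def)
  have a: "cinner w (A v) = a w v" for v w
    using assms(2,3) V by (simp add: associated_operator_def)
  have eqI: "x = y" if "\<And>w. cinner w x = cinner w y" for x y :: 'a
    using that[of "x - y"] cinner_self_eq_0[of "x - y"] by (simp add: cinner_diff_right)
  show ?thesis
    using assms(1) V
    by (intro clinearI eqI) (simp_all add: a cinner_add_right cinner_scaleC_right sesquilinear_on_def)
qed

theorem theorem4p1: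
  fixes V :: "'a::complex_hilbert_space set"
    and a ip\<^sub>V :: "'a \<Rightarrow> 'a \<Rightarrow> complex"
    and A :: "'a \<Rightarrow> 'a"
    and \<alpha> M r :: real
    and \<mu> :: complex
    and m :: nat
    and S1 S2 :: "real \<Rightarrow> 'a set"
    and N :: "real \<Rightarrow> nat"
    and U :: "'a set"
  assumes separable: "separable_space (euclidean :: 'a topology)"
    and form: "sesquilinear_on V a" "closure V = UNIV" "closed_form V a"
    and sectorial: "\<alpha> > 0" "M > 0" "sectorial_form V a \<alpha> M"
    and V_hilbert: "hilbert_on V ip\<^sub>V" "equivalent_ip V ip\<^sub>V (hermitian_part a)"
    and A: "associated_operator V a A"
    and A_bounded: "op_dom V a = UNIV" "\<exists>C. \<forall>v. norm (A v) \<le> C * norm v"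
    and lam: "\<mu> \<noteq> 0" "isolated_eigenvalue_mult A \<mu> m"
    and U_def: "U = gen_eigenspace A \<mu>"
    and S_subset: "\<And>h. h > 0 \<Longrightarrow> S1 h \<subseteq> V \<and> S2 h \<subseteq> V"
    and S_dim: "\<And>h. h > 0 \<Longrightarrow> has_cdim (S1 h) (N h) \<and> has_cdim (S2 h) (N h)"
    and beta: "\<And>h. h > 0 \<Longrightarrow> inf_sup (form_norm ip\<^sub>V) a (S1 h) (S2 h) > 0"
    and beta0: "\<And>h. h > 0 \<Longrightarrow> inf_sup norm cinner (S1 h) (S2 h) > 0"
    and \<Gamma>: "r > 0" "0 \<notin> cball \<mu> r" "spectrum A \<inter> cball \<mu> r = {\<mu>}"
    and conv1: "\<And>v. ((\<lambda>h. inverse (inf_sup norm cinner (S1 h) (S2 h)) *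
                           (INF w\<in>S1 h. ennreal (norm (v - w)))) \<longlongrightarrow> 0) (at_right 0)"
    and conv2: "((\<lambda>h. operator_gap (S1 h) (galerkin_op A (S1 h) (S2 h)) (op_dom V a) A)
                   \<longlongrightarrow> 0) (at_right 0)"
  shows "\<exists>h0>0. \<exists>c>0. \<forall>h. 0 < h \<and> h < h0 \<longrightarrow>
           (\<forall>u\<in>U. norm u = 1 \<longrightarrow>
             (\<exists>u\<^sub>h \<in> range (riesz_projection (galerkin_op A (S1 h) (S2 h)) \<mu> r).
                ennreal (norm (u\<^sub>h - oblique_proj (S1 h) (S2 h) u))
                  \<le> ennreal c * galerkin_eps A U (S1 h) (S2 h) * subspace_gap U (S1 h)))"
proof -
  have A_lin: "clinear A"
    using form(1) A A_bounded(1) by (rule associated_operator_clinear)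
  have "sphere \<mu> r \<inter> spectrum A = {}"
    using \<Gamma>(1,3) by (auto simp: set_eq_iff)
  then obtain \<gamma> where \<gamma>: "0 < \<gamma>"
      "\<And>z y. z \<in> sphere \<mu> r \<Longrightarrow> \<gamma> * norm y \<le> norm (z *\<^sub>C y - A y)"
    using uniform_lower_bound_off_spectrum[of "sphere \<mu> r" A] compact_sphere by blast
  define \<rho> where "\<rho> = cmod \<mu> + r"
  have \<rho>: "cmod z \<le> \<rho>" if "z \<in> sphere \<mu> r" for z
    using that norm_triangle_sub[of z \<mu>] by (simp add: \<rho>_def dist_norm norm_minus_commute)
  have "0 < \<gamma> / (2 * (1 + \<rho> + \<gamma>)\<^sup>2)"
    using \<gamma>(1) \<Gamma>(1) norm_ge_zero[of \<mu>] unfolding \<rho>_def by (intro divide_pos_pos mult_pos_pos zero_less_power) linarith+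
  then have "\<forall>\<^sub>F h in at_right 0. operator_gap (S1 h) (galerkin_op A (S1 h) (S2 h)) (op_dom V a) A
      < ennreal (\<gamma> / (2 * (1 + \<rho> + \<gamma>)\<^sup>2))"
    using conv2 by (intro order_tendstoD(2)) auto
  then obtain h0 where h0: "h0 > 0" "\<And>h. 0 < h \<Longrightarrow> h < h0 \<Longrightarrow>
      operator_gap (S1 h) (galerkin_op A (S1 h) (S2 h)) UNIV A < ennreal (\<gamma> / (2 * (1 + \<rho> + \<gamma>)\<^sup>2))"
    unfolding eventually_at_right_field A_bounded(1) by blast
  \<comment> \<open>The factor \<open>\<gamma> / 4\<close> is the lower bound that \<open>z - Ah\<close> inherits from \<open>z - A\<close> for small \<open>h\<close>.\<close>
  define c where "c = r / (\<gamma> * (\<gamma> / 4))"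
  have c: "c > 0" using \<gamma>(1) \<Gamma>(1) by (simp add: c_def)
  have "\<exists>u\<^sub>h \<in> range (riesz_projection (galerkin_op A (S1 h) (S2 h)) \<mu> r).
      ennreal (norm (u\<^sub>h - oblique_proj (S1 h) (S2 h) u))
        \<le> ennreal c * galerkin_eps A U (S1 h) (S2 h) * subspace_gap U (S1 h)"
    if h: "0 < h" "h < h0" and u: "u \<in> U" "norm u = 1" for h u
  proof (cases "galerkin_eps A U (S1 h) (S2 h) * subspace_gap U (S1 h) = \<infinity>")
    case True
    then have "ennreal c * galerkin_eps A U (S1 h) (S2 h) * subspace_gap U (S1 h) = \<infinity>"
      using c by (simp add: mult.assoc ennreal_mult_top)
    then show ?thesis by simp
  next
    case False
    have "oblique_pair (S1 h) (S2 h)"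
      using S_dim[OF h(1)] beta0[OF h(1)] oblique_pair_of_inf_sup_pos by blast
    then interpret galerkin "S1 h" "S2 h" A "N h"
      using S_dim[OF h(1)] A_lin by (intro galerkin.intro galerkin_axioms.intro) auto
    obtain \<eta> where \<eta>: "0 \<le> \<eta>" "galerkin_eps A U (S1 h) (S2 h) * subspace_gap U (S1 h) = ennreal \<eta>"
      using False by (metis ennreal_cases infinity_ennreal_def)
    have "norm (proj (A (w - proj w))) \<le> \<eta> * norm w" if "w \<in> U" for w
      using consistency_error_le[OF that] \<eta> by (simp add: ennreal_mult'[symmetric])
    moreover have "\<gamma> / 4 * norm x \<le> norm (z *\<^sub>C x - Ah x)" if "z \<in> sphere \<mu> r" "x \<in> S1 h" for z x
      using lower_bound_of_operator_gap[OF \<gamma>(1) \<gamma>(2)[OF that(1)] \<rho>[OF that(1)] h0(2)[OF h] that(2)] .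
    ultimately have "norm (riesz_projection Ah \<mu> r (proj u) - proj u) \<le> c * \<eta> * norm u"
      unfolding c_def using \<Gamma>(1,2) \<gamma> \<eta>(1) u(1)
      by (intro riesz_projection_error) (auto simp: U_def)
    then have "ennreal (norm (riesz_projection Ah \<mu> r (proj u) - proj u)) \<le> ennreal c * ennreal \<eta>"
      using c u(2) by (simp add: ennreal_mult'[symmetric] ennreal_leI)
    then show ?thesis
      using \<eta>(2) by (intro bexI[of _ "riesz_projection Ah \<mu> r (proj u)"]) (auto simp: mult.assoc)
  qed
  with h0(1) c show ?thesis by blast
qed

end
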